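(* Let $\mathcal H$ be a real Hilbert space and $\beta>0$. Let $f:\mathcal H\to\mathbb R$ be a convex function which is twice continuously differentiable, and such that $\operatorname{argmin}_{\mathcal H}f\neq\emptyset$. Suppose that $\nabla f$ is Lipschitz continuous on the bounded subsets of $\mathcal H$. Let $\phi:\mathcal H\to\mathbb R_+$ be a damping potential. Then, for any solution trajectory $x:[0,+\infty[\to\mathcal H$ of $$\ddot x(t)+\partial\phi\big(\dot x(t)+\beta\nabla f(x(t))\big)+\beta\nabla^2f(x(t))\dot x(t)+\nabla f(x(t))\ni0$$ we have: (i) the function $t\mapsto\frac12\|\dot x(t)+\beta\nabla f(x(t))\|^2+f(x(t))$ is nonincreasing; (ii) $\int_0^{+\infty}\phi\big(\dot x(t)+\beta\nabla f(x(t))\big)\,dt<+\infty$; (iii) $\int_0^{+\infty}\|\nabla f(x(t))\|^2\,dt<+\infty$. Suppose moreover that there exists $r>0$ such that $\phi(u)\ge r\|u\|$ for all $u\in\mathcal H$. Then: (a) the trajectory $x(\cdot)$ converges weakly as $t\to+\infty$, and its limit belongs to $\operatorname{argmin}_{\mathcal H}f$; (b) $\dot x(t)$ and $\nabla f(x(t))$ converge strongly to zero as $t\to+\infty$.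
   Context: A function $\phi:\mathcal H\to\mathbb R_+$ is a damping potential if: (i) $\phi$ is nonnegative, convex and continuous; (ii) $\phi(0)=0=\min_{\mathcal H}\phi$; (iii) for every $R>0$, $\sup_{\|u\|\le R}\|(\partial\phi)^0(u)\|<+\infty$, where $\partial\phi$ is the convex subdifferential and $(\partial\phi)^0(u)$ is the element of minimal norm of $\partial\phi(u)$. A solution trajectory (strong global solution) is a function $x\in\mathcal C^1([0,+\infty[;\mathcal H)$ such that, for all $T>0$, $\dot x$ is Lipschitz continuous on $(0,T)$ and $\ddot x\in L^\infty(0,T;\mathcal H)$, and the inclusion holds for almost every $t>0$. *)

theory Defs
  imports "HOL-Analysis.Analysis"
begin

definition argmin :: "('a \<Rightarrow> real) \<Rightarrow> 'a set" where
  "argmin f = {u. is_arg_min f (\<lambda>_. True) u}"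

definition subdifferential :: "('a::real_inner \<Rightarrow> real) \<Rightarrow> 'a \<Rightarrow> 'a set" where
  "subdifferential \<phi> u = {p. \<forall>v. \<phi> u + p \<bullet> (v - u) \<le> \<phi> v}"

(* For convex continuous \<phi> on a Hilbert space, the subdifferential is nonempty, closed and
   convex, so the element selected here exists and is unique. *)
definition minimal_subgradient :: "('a::real_inner \<Rightarrow> real) \<Rightarrow> 'a \<Rightarrow> 'a" where
  "minimal_subgradient \<phi> u = arg_min norm (\<lambda>p. p \<in> subdifferential \<phi> u)"

definition damping_potential :: "('a::real_inner \<Rightarrow> real) \<Rightarrow> bool" where
  "damping_potential \<phi> \<longleftrightarrow>
     (\<forall>u. 0 \<le> \<phi> u) \<and> convex_on UNIV \<phi> \<and> continuous_on UNIV \<phi> \<and>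
     \<phi> 0 = 0 \<and> 0 \<in> argmin \<phi> \<and>
     (\<forall>R>0. bdd_above ((\<lambda>u. norm (minimal_subgradient \<phi> u)) ` cball 0 R))"

(* Strong (Bochner) measurability.  Plain Borel measurability would be too weak
   here, since the Hilbert space is not assumed separable. *)
definition strongly_measurable :: "'b measure \<Rightarrow> ('b \<Rightarrow> 'a::topological_space) \<Rightarrow> bool" where
  "strongly_measurable M g \<longleftrightarrow>
     (\<exists>s. (\<forall>n::nat. simple_function M (s n)) \<and> (AE t in M. (\<lambda>n. s n t) \<longlonglongrightarrow> g t))"

definition L_infinity :: "'b measure \<Rightarrow> ('b \<Rightarrow> 'a::real_normed_vector) \<Rightarrow> bool" where
  "L_infinity M g \<longleftrightarrow> strongly_measurable M g \<and> (\<exists>C. AE t in M. norm (g t) \<le> C)"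

(* f' and f'' stand for the gradient and the Hessian of f, x' for the derivative of x
   (one-sided at 0) and x'' for the almost everywhere derivative of x'. *)
definition solution_trajectory ::
  "real \<Rightarrow> ('a::real_inner \<Rightarrow> 'a) \<Rightarrow> ('a \<Rightarrow> 'a \<Rightarrow>\<^sub>L 'a) \<Rightarrow> ('a \<Rightarrow> real)
     \<Rightarrow> (real \<Rightarrow> 'a) \<Rightarrow> (real \<Rightarrow> 'a) \<Rightarrow> bool" where
  "solution_trajectory \<beta> f' f'' \<phi> x x' \<longleftrightarrow>
     (\<forall>t\<ge>0. (x has_vector_derivative x' t) (at t within {0..})) \<and>
     continuous_on {0..} x' \<and>
     (\<forall>T>0. \<exists>L. L-lipschitz_on {0<..<T} x') \<and>
     (\<exists>x''. (AE t\<in>{0<..} in lborel. (x' has_vector_derivative x'' t) (at t)) \<and>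
            (\<forall>T>0. L_infinity (restrict_space lborel {0<..<T}) x'') \<and>
            (AE t\<in>{0<..} in lborel.
               0 \<in> {x'' t + p + \<beta> *\<^sub>R blinfun_apply (f'' (x t)) (x' t) + f' (x t) | p.
                    p \<in> subdifferential \<phi> (x' t + \<beta> *\<^sub>R f' (x t))}))"

definition weakly_convergent_to ::
  "('b \<Rightarrow> 'a::real_inner) \<Rightarrow> 'a \<Rightarrow> 'b filter \<Rightarrow> bool" where
  "weakly_convergent_to x l F \<longleftrightarrow> (\<forall>y. ((\<lambda>t. x t \<bullet> y) \<longlongrightarrow> l \<bullet> y) F)"

end

theory Submission
  imports Defs
begin

text \<open>Let \<open>u = x' + \<beta> \<nabla>f(x)\<close>. The inclusion then reads \<open>u' + \<partial>\<phi>(u) + \<nabla>f(x) \<ni> 0\<close>, and the second-order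
system becomes a first-order one in which \<open>u\<close> is damped and \<open>x\<close> follows the gradient flow
\<open>x' = - \<beta> \<nabla>f(x) + u\<close> perturbed by \<open>u\<close>.

The energy \<open>E = \<parallel>u\<parallel>\<^sup>2 / 2 + f(x)\<close> satisfies \<open>E' \<le> - \<phi>(u) - \<beta> \<parallel>\<nabla>f(x)\<parallel>\<^sup>2\<close> almost everywhere
(lemma \<open>energy_inequality\<close>). Since \<open>E\<close> is bounded below by the minimum of \<open>f\<close>, it is nonincreasing
and both dissipation terms are integrable. Passing from the derivative to the function is
legitimate because \<open>x'\<close> is locally Lipschitz (\<open>nonincreasing_if_AE_derivative_nonpos\<close>).

If \<open>\<phi>(u) \<ge> r \<parallel>u\<parallel>\<close>, then \<open>u\<close> is integrable, and a Gronwall argument shows that the distance of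
\<open>x\<close> to each minimizer converges (\<open>perturbed_gradient_flow_distance_tendsto\<close>). Hence \<open>x\<close> is
bounded, its speed is bounded, and \<open>\<nabla>f(x)\<close>, being square integrable and Lipschitz in time, tends to
zero. By convexity \<open>f(x)\<close> tends to the minimum. So \<open>\<parallel>u\<parallel>\<^sup>2 = 2 (E - f(x))\<close> converges, and
integrability forces the limit to be zero; thus \<open>x' = u - \<beta> \<nabla>f(x)\<close> tends to zero as well. Weak
convergence of \<open>x\<close> to a minimizer follows from Opial's lemma (\<open>opial_weak_convergence\<close>).\<close>

section \<open>Monotonicity from an almost everywhere derivative\<close>

text \<open>A pointwise Lipschitz function maps null sets to null sets, which replaces the theory of absolutely
continuous functions. If \<open>h a < h b\<close>, subtract a small linear function to get \<open>k\<close> with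
\<open>k a < k b\<close> whose derivative is strictly negative off \<open>N\<close>. Since \<open>k\<close> maps \<open>N\<close> to a null set,
some level \<open>y\<close> between \<open>k a\<close> and \<open>k b\<close> is not attained on \<open>N\<close>. At the last time where
\<open>k \<le> y\<close> the function equals \<open>y\<close> and exceeds it afterwards, so it cannot have a negative
derivative there.\<close>

lemma nonincreasing_if_AE_derivative_nonpos:
  fixes h :: "real \<Rightarrow> real"
  assumes "a \<le> b" and cont: "continuous_on {a..b} h"
    and lip: "\<And>t. a < t \<Longrightarrow> t < b \<Longrightarrow> \<exists>B. \<forall>\<^sub>F s in at t. \<bar>h s - h t\<bar> \<le> B * \<bar>s - t\<bar>"
    and N: "negligible N"
    and deriv: "\<And>t. a < t \<Longrightarrow> t < b \<Longrightarrow> t \<notin> N \<Longrightarrow> \<exists>D\<le>0. (h has_real_derivative D) (at t)"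
  shows "h b \<le> h a"
proof (rule ccontr)
  assume "\<not> h b \<le> h a"
  then have ab: "h a < h b" by simp
  with \<open>a \<le> b\<close> have "a < b" by (cases "a = b") auto
  \<comment> \<open>With this slope the linear correction eats up exactly half of the increase of \<open>h\<close>.\<close>
  define e where "e = (h b - h a) / 2 / (b - a)"
  have "e > 0" using ab \<open>a < b\<close> by (simp add: e_def)
  define k where "k t = h t - e * (t - a)" for t
  have ka: "k a = h a" by (simp add: k_def)
  have "e * (b - a) = (h b - h a) / 2"
    by (subst nonzero_eq_divide_eq[symmetric]) (use \<open>a < b\<close> in \<open>simp_all add: e_def\<close>)
  then have kb: "k a < k b" using ab by (simp add: k_def)
  have kcont: "continuous_on {a..b} k"
    unfolding k_def by (intro continuous_intros cont)
  have "negligible (k ` (N \<inter> {a<..<b}))"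
  proof (rule negligible_locally_Lipschitz_image)
    show "negligible (N \<inter> {a<..<b})" using N by (simp add: negligible_Int)
    fix t assume t: "t \<in> N \<inter> {a<..<b}"
    then obtain B where "\<forall>\<^sub>F s in at t. \<bar>h s - h t\<bar> \<le> B * \<bar>s - t\<bar>" using lip[of t] by auto
    then obtain T where T: "open T" "t \<in> T"
      "\<And>s. s \<in> T \<Longrightarrow> s \<noteq> t \<Longrightarrow> \<bar>h s - h t\<bar> \<le> B * \<bar>s - t\<bar>"
      unfolding eventually_at_topological by auto
    have "\<bar>k s - k t\<bar> \<le> (B + e) * \<bar>s - t\<bar>" if "s \<in> T" for s
    proof (cases "s = t")
      case False
      have "k s - k t = (h s - h t) - e * (s - t)" by (simp add: k_def algebra_simps)
      then have "\<bar>k s - k t\<bar> \<le> \<bar>h s - h t\<bar> + e * \<bar>s - t\<bar>"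
        using \<open>e > 0\<close> abs_triangle_ineq4[of "h s - h t" "e * (s - t)"] by (simp add: abs_mult)
      with T(3)[OF that False] show ?thesis by (simp add: algebra_simps)
    qed simp
    with T show "\<exists>T B. open T \<and> t \<in> T \<and>
        (\<forall>y\<in>N \<inter> {a<..<b} \<inter> T. norm (k y - k t) \<le> B * norm (y - t))"
      by (intro exI[of _ T] exI[of _ "B + e"]) auto
  qed simp
  moreover have "\<not> negligible {k a<..<k b}"
    using kb negligible_interval(2)[of "k a" "k b"] by simp
  ultimately obtain y where y: "k a < y" "y < k b" "y \<notin> k ` (N \<inter> {a<..<b})"
    using negligible_subset[of "k ` (N \<inter> {a<..<b})" "{k a<..<k b}"] by (meson greaterThanLessThan_iff subsetI)
  define S where "S = {s \<in> {a..b}. k s \<le> y}"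
  define t where "t = Sup S"
  have "closed S" unfolding S_def
    by (rule continuous_on_closed_Collect_le[OF kcont]) auto
  moreover have "a \<in> S" using y \<open>a < b\<close> by (simp add: S_def)
  moreover have bdd: "bdd_above S" by (auto simp: S_def intro: bdd_aboveI)
  ultimately have "t \<in> S" unfolding t_def by (metis closed_contains_Sup empty_iff)
  then have t: "a \<le> t" "t \<le> b" "k t \<le> y" by (auto simp: S_def)
  have upper: "s \<le> t" if "s \<in> S" for s using that bdd by (simp add: t_def cSup_upper)
  have "t < b" using t y by (cases "t = b") auto
  have "k t = y"
  proof -
    have "\<exists>s\<ge>t. s \<le> b \<and> k s = y"
      using t y by (intro IVT' continuous_on_subset[OF kcont]) auto
    then obtain s where s: "t \<le> s" "s \<le> b" "k s = y" by blast
    then have "s \<in> S" using t by (simp add: S_def)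
    with upper[of s] s show ?thesis by simp
  qed
  have "a < t" using t y \<open>k t = y\<close> by (cases "a = t") auto
  have "t \<notin> N" using y(3) \<open>k t = y\<close> \<open>a < t\<close> \<open>t < b\<close> by auto
  then obtain D where D: "D \<le> 0" "(h has_real_derivative D) (at t)"
    using deriv \<open>a < t\<close> \<open>t < b\<close> by blast
  have "(k has_real_derivative D - e) (at t)"
    unfolding k_def by (rule derivative_eq_intros D refl | simp)+
  moreover have "D - e < 0" using D \<open>e > 0\<close> by simp
  ultimately obtain d where d: "d > 0" "\<And>s. 0 < s \<Longrightarrow> s < d \<Longrightarrow> k (t + s) < k t"
    using DERIV_neg_dec_right[of k "D - e" t] by auto
  define s where "s = min d (b - t) / 2"
  have s: "0 < s" "s < d" "t + s \<le> b"
    using d \<open>t < b\<close> by (auto simp: s_def min_def field_simps)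
  have "k (t + s) < k t" using d s by blast
  then have "t + s \<in> S" using s t by (simp add: S_def)
  from upper[OF this] s show False by simp
qed

section \<open>Primitives of nonnegative functions on a half-line\<close>

text \<open>The derivative is two-sided even at \<open>0\<close>, where \<open>g\<close> need not be continuous from the left: the
function that is integrated extends \<open>g\<close> by \<open>g 0\<close> to the negative axis. This way no one-sided
derivatives occur at the initial time.\<close>

lemma primitive_on_atLeast:
  fixes g :: "real \<Rightarrow> real"
  assumes "continuous_on {0..} g"
  obtains G where "\<And>t. t \<ge> 0 \<Longrightarrow> (G has_real_derivative g t) (at t)" "G 0 = 0"
proof -
  define h where "h t = g (max 0 t)" for t
  have h: "continuous_on A h" for A
    unfolding h_def by (rule continuous_on_compose2[OF assms]) (auto intro!: continuous_intros)
  define G where "G t = integral {-1..t} h - integral {-1..0} h" for t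
  show ?thesis
  proof
    fix t :: real assume "t \<ge> 0"
    then have "((\<lambda>x. integral {-1..x} h) has_real_derivative h t) (at t within {-1..t+1})"
      by (intro integral_has_real_derivative h) auto
    moreover have "at t within {-1..t+1} = at t"
      using \<open>t \<ge> 0\<close> by (intro at_within_interior) auto
    ultimately have "((\<lambda>x. integral {-1..x} h) has_real_derivative h t) (at t)" by simp
    from DERIV_diff[OF this DERIV_const] show "(G has_real_derivative g t) (at t)"
      using \<open>t \<ge> 0\<close> by (simp add: G_def[abs_def] h_def)
  qed (simp add: G_def)
qed

lemma antimono_on_bounded_below_tendsto:
  fixes F :: "real \<Rightarrow> real"
  assumes mono: "antimono_on {a..} F" and bound: "\<And>t. t \<ge> a \<Longrightarrow> m \<le> F t"
  obtains l where "(F \<longlongrightarrow> l) at_top"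
proof
  have bdd: "bdd_below (F ` {a..})" using bound by (auto intro!: bdd_belowI)
  show "(F \<longlongrightarrow> Inf (F ` {a..})) at_top"
  proof (rule decreasing_tendsto)
    show "\<forall>\<^sub>F t in at_top. Inf (F ` {a..}) \<le> F t"
      using eventually_ge_at_top[of a] by eventually_elim (auto intro!: cInf_lower bdd)
    fix c assume "Inf (F ` {a..}) < c"
    then obtain s where s: "s \<ge> a" "F s < c" 
      using cInf_lessD[of "F ` {a..}" c] by auto
    show "\<forall>\<^sub>F t in at_top. F t < c"
      using eventually_ge_at_top[of s]
    proof eventually_elim
      fix t assume "t \<ge> s"
      then have "F t \<le> F s" using mono s by (auto simp: monotone_on_def)
      with s show "F t < c" by simp
    qed
  qed
qed

lemma primitive_nonneg_mono:
  fixes G g :: "real \<Rightarrow> real"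
  assumes "\<And>t. t \<ge> a \<Longrightarrow> (G has_real_derivative g t) (at t)" "\<And>t. t \<ge> a \<Longrightarrow> 0 \<le> g t"
    and "a \<le> s" "s \<le> t"
  shows "G s \<le> G t"
  by (rule DERIV_nonneg_imp_nondecreasing[OF \<open>s \<le> t\<close>]) (use assms in \<open>meson order_trans\<close>)

lemma bounded_primitive_tendsto:
  fixes G g :: "real \<Rightarrow> real"
  assumes "\<And>t. t \<ge> a \<Longrightarrow> (G has_real_derivative g t) (at t)" "\<And>t. t \<ge> a \<Longrightarrow> 0 \<le> g t"
    and "\<And>t. t \<ge> a \<Longrightarrow> G t \<le> M"
  obtains l where "(G \<longlongrightarrow> l) at_top"
proof -
  have "antimono_on {a..} (\<lambda>t. - G t)"
    using primitive_nonneg_mono[of a G g] assms by (auto simp: monotone_on_def)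
  then obtain l where "((\<lambda>t. - G t) \<longlongrightarrow> l) at_top"
    by (rule antimono_on_bounded_below_tendsto[where m = "- M"]) (use assms(3) in auto)
  from tendsto_minus[OF this] that show ?thesis by simp
qed

lemma nn_integral_finite_if_primitive_bounded:
  fixes G g :: "real \<Rightarrow> real"
  assumes g: "continuous_on {0..} g"
    and G: "\<And>t. t \<ge> 0 \<Longrightarrow> (G has_real_derivative g t) (at t)"
    and nonneg: "\<And>t. t \<ge> 0 \<Longrightarrow> 0 \<le> g t"
    and bound: "\<And>t. t \<ge> 0 \<Longrightarrow> G t \<le> M"
  shows "(\<integral>\<^sup>+t\<in>{0..}. ennreal (g t) \<partial>lborel) < \<infinity>"
proof -
  obtain l where l: "(G \<longlongrightarrow> l) at_top"
    using bounded_primitive_tendsto[OF G nonneg bound] by blast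
  have cont: "continuous_on UNIV (\<lambda>t. g (max 0 t))"
    by (rule continuous_on_compose2[OF g]) (auto intro!: continuous_intros)
  have "(\<integral>\<^sup>+t. ennreal (g t) * indicator {0..} t \<partial>lborel)
      = (\<integral>\<^sup>+t. ennreal (g (max 0 t)) * indicator {0..} t \<partial>lborel)"
    by (intro nn_integral_cong) (auto simp: indicator_def)
  also have "\<dots> = l - G 0"
    by (intro nn_integral_FTC_atLeast l borel_measurable_continuous_onI cont)
      (use G nonneg in auto)
  finally show ?thesis by simp
qed

text \<open>A variant of Barbalat's lemma: by the mean value theorem, \<open>(G (t + d) - G t) / d\<close> is a value of
\<open>g\<close> on \<open>{t..t + d}\<close>, where \<open>g\<close> hardly varies, and it tends to \<open>0\<close> since \<open>G\<close> converges.
The condition covers both functions that are Lipschitz near infinity and functions that have a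
limit.\<close>

lemma slowly_oscillating_tendsto_zero:
  fixes G g :: "real \<Rightarrow> real"
  assumes G: "\<And>t. t \<ge> a \<Longrightarrow> (G has_real_derivative g t) (at t)"
    and lim: "(G \<longlongrightarrow> l) at_top"
    and slow: "\<And>e. e > 0 \<Longrightarrow>
        \<exists>d>0. \<forall>\<^sub>F t in at_top. \<forall>s\<in>{t..t+d}. \<bar>g s - g t\<bar> \<le> e"
  shows "(g \<longlongrightarrow> 0) at_top"
proof (rule tendstoI)
  fix e :: real assume "e > 0"
  then obtain d where d: "d > 0" "\<forall>\<^sub>F t in at_top. \<forall>s\<in>{t..t+d}. \<bar>g s - g t\<bar> \<le> e / 3"
    using slow[of "e / 3"] by auto
  have "((\<lambda>t. G (t + d)) \<longlongrightarrow> l) at_top"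
    by (rule filterlim_compose[OF lim]) 
      (rule filterlim_tendsto_add_at_top[OF tendsto_const filterlim_ident, of d, unfolded add.commute[of d]])
  then have "((\<lambda>t. (G (t + d) - G t) / d) \<longlongrightarrow> (l - l) / d) at_top"
    using d by (intro tendsto_intros lim) auto
  then have "\<forall>\<^sub>F t in at_top. \<bar>(G (t + d) - G t) / d\<bar> < e / 3"
    using \<open>e > 0\<close> by (auto dest!: tendstoD[where e = "e / 3"] simp: dist_real_def)
  then show "\<forall>\<^sub>F t in at_top. dist (g t) 0 < e"
    using d(2) eventually_ge_at_top[of a]
  proof eventually_elim
    fix t
    assume t: "\<bar>(G (t + d) - G t) / d\<bar> < e / 3" "\<forall>s\<in>{t..t+d}. \<bar>g s - g t\<bar> \<le> e / 3" "a \<le> t"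
    obtain s where s: "t < s" "s < t + d" "G (t + d) - G t = (t + d - t) * g s"
      using MVT2[of t "t + d" G g] d G t(3) by auto
    then have "g s = (G (t + d) - G t) / d" using d by simp
    then have "\<bar>g s\<bar> < e / 3" using t by simp
    moreover have "\<bar>g s - g t\<bar> \<le> e / 3" using t(2) s by simp
    ultimately have "\<bar>g t\<bar> < e" using \<open>e > 0\<close> by linarith
    then show "dist (g t) 0 < e" by (simp add: dist_real_def)
  qed
qed

section \<open>Weak convergence in a Hilbert space\<close>

text \<open>This intersection property plays the role of weak compactness of bounded sets. Elements of
\<open>D n\<close> of almost minimal norm form a Cauchy sequence, because by the parallelogram law two of
them that are far apart would have a midpoint of too small norm.\<close>

lemma nested_convex_Inter_nonempty:
  fixes D :: "nat \<Rightarrow> 'a::{real_inner,complete_space} set"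
  assumes closed: "\<And>n. closed (D n)" and convex: "\<And>n. convex (D n)"
    and ne: "\<And>n. D n \<noteq> {}" and decreasing: "\<And>m n. m \<le> n \<Longrightarrow> D n \<subseteq> D m"
    and bounded: "bounded (D 0)"
  obtains c where "\<And>n. c \<in> D n"
proof -
  define d where "d n = Inf ((\<lambda>w. (norm w)\<^sup>2) ` D n)" for n
  have bdd: "bdd_below ((\<lambda>w. (norm w)\<^sup>2) ` D n)" for n by (auto intro!: bdd_belowI[of _ 0])
  have lower: "d n \<le> (norm w)\<^sup>2" if "w \<in> D n" for n w
    unfolding d_def using that by (intro cInf_lower bdd) auto
  obtain M where M: "\<And>w. w \<in> D 0 \<Longrightarrow> norm w \<le> M" using bounded by (auto simp: bounded_iff)
  have "incseq d"
    unfolding incseq_def d_def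
    using decreasing ne bdd by (auto intro!: cInf_superset_mono)
  moreover have "d n \<le> M\<^sup>2" for n
  proof -
    obtain w where "w \<in> D n" using ne by blast
    moreover from this have "norm w \<le> M" using M decreasing[of 0 n] by auto
    ultimately show ?thesis using lower[of w n] power_mono[of "norm w" M 2] by simp
  qed
  ultimately obtain L where L: "d \<longlonglongrightarrow> L" "\<And>n. d n \<le> L"
    using incseq_convergent[of d] by blast
  have "\<exists>w\<in>D n. (norm w)\<^sup>2 < d n + inverse (real (Suc n))" for n
    using cInf_lessD[of "(\<lambda>w. (norm w)\<^sup>2) ` D n" "d n + inverse (real (Suc n))"] ne
    by (auto simp: d_def)
  then obtain w where w: "\<And>n. w n \<in> D n" "\<And>n. (norm (w n))\<^sup>2 < d n + inverse (real (Suc n))"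
    by metis
  have close: "(norm (w m - w n))\<^sup>2 \<le> 4 * (L - d N + inverse (real (Suc N)))"
    if "N \<le> m" "N \<le> n" for m n N
  proof -
    have "w m \<in> D N" "w n \<in> D N" using w decreasing that by blast+
    then have "(1/2) *\<^sub>R w m + (1/2) *\<^sub>R w n \<in> D N"
      using convexD[OF convex, of "w m" N "w n" "1/2" "1/2"] by simp
    then have mid: "d N \<le> (norm ((1/2) *\<^sub>R (w m + w n)))\<^sup>2"
      using lower by (simp add: scaleR_right_distrib)
    have "4 * (norm ((1/2) *\<^sub>R (w m + w n)))\<^sup>2 = (norm (w m + w n))\<^sup>2"
      by (simp add: power_mult_distrib power_divide)
    then have "(norm (w m - w n))\<^sup>2
        = 2 * (norm (w m))\<^sup>2 + 2 * (norm (w n))\<^sup>2 - 4 * (norm ((1/2) *\<^sub>R (w m + w n)))\<^sup>2"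
      by (simp add: power2_norm_eq_inner inner_commute algebra_simps)
    moreover have "(norm (w k))\<^sup>2 \<le> L + inverse (real (Suc N))" if "N \<le> k" for k
    proof -
      have "inverse (real (Suc k)) \<le> inverse (real (Suc N))" using that by simp
      with w(2)[of k] L(2)[of k] show ?thesis by linarith
    qed
    from this[OF that(1)] this[OF that(2)] mid calculation show ?thesis by argo
  qed
  have small: "(\<lambda>N. 4 * (L - d N + inverse (real (Suc N)))) \<longlonglongrightarrow> 4 * (L - L + 0)"
    by (intro tendsto_intros L LIMSEQ_inverse_real_of_nat)
  have "Cauchy w"
  proof (rule metric_CauchyI)
    fix e :: real assume "e > 0"
    then have "\<forall>\<^sub>F N in sequentially. 4 * (L - d N + inverse (real (Suc N))) < e\<^sup>2"
      using order_tendstoD(2)[OF small, of "e\<^sup>2"] by simp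
    then obtain N where N: "4 * (L - d N + inverse (real (Suc N))) < e\<^sup>2"
      by (auto simp: eventually_sequentially)
    have "dist (w m) (w n) < e" if "N \<le> m" "N \<le> n" for m n
      using close[OF that] N \<open>e > 0\<close> power2_less_imp_less[of "norm (w m - w n)" e]
      by (simp add: dist_norm)
    then show "\<exists>N. \<forall>m\<ge>N. \<forall>n\<ge>N. dist (w m) (w n) < e" by blast
  qed
  then obtain c where c: "w \<longlonglongrightarrow> c" using Cauchy_convergent convergent_def by blast
  have "c \<in> D n" for n
  proof (rule Lim_in_closed_set[OF closed _ _ c])
    show "\<forall>\<^sub>F k in sequentially. w k \<in> D n"
      using eventually_ge_at_top[of n] by eventually_elim (use w decreasing in blast)
  qed simp
  with that show ?thesis by blast
qed

lemma closure_convex_hull_subset: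
  fixes C :: "'a::real_normed_vector set"
  assumes "A \<subseteq> C" "convex C" "closed C"
  shows "closure (convex hull A) \<subseteq> C"
  using assms by (simp add: closure_minimal hull_minimal)

text \<open>Opial's lemma. The weak cluster points of \<open>x\<close> are replaced by the points that lie in the closed
convex hull of every tail. Such a point \<open>l\<close> exists by the intersection property, and it belongs
to \<open>S\<close>. It is unique: for \<open>c\<close> and \<open>l\<close> in \<open>S\<close>, convergence of the two squared distances makes
\<open>x t \<bullet> (c - l)\<close> converge, and the limit is the value of the functional \<open>\<lambda>v. v \<bullet> (c - l)\<close> at
both points. If \<open>x t \<bullet> y\<close> exceeded \<open>l \<bullet> y + e\<close> for arbitrarily large \<open>t\<close>, then intersecting the
closed convex hulls with that half-space would give a second such point.\<close>

lemma opial_weak_convergence: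
  fixes x :: "real \<Rightarrow> 'a::{real_inner,complete_space}"
  assumes bounded: "bounded (x ` {a..})"
    and fejer: "\<And>z. z \<in> S \<Longrightarrow> \<exists>l. ((\<lambda>t. (norm (x t - z))\<^sup>2) \<longlongrightarrow> l) at_top"
    and cluster: "\<And>c. (\<And>T. c \<in> closure (convex hull (x ` {T..}))) \<Longrightarrow> c \<in> S"
  shows "\<exists>l\<in>S. weakly_convergent_to x l at_top"
proof -
  define C where "C T = closure (convex hull (x ` {T..}))" for T
  have x_in_C: "x t \<in> C T" if "t \<ge> T" for t T
    unfolding C_def using that by (intro subsetD[OF closure_subset hull_inc]) auto
  have C_closed: "closed (C T)" and C_convex: "convex (C T)" for T by (auto simp: C_def)
  have C_mono: "C T \<subseteq> C s" if "s \<le> T" for s T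
    unfolding C_def using that by (intro closure_mono hull_mono) auto
  have bddC: "bounded (C a)" unfolding C_def
    using bounded by (intro bounded_closure bounded_convex_hull)
  have meet: "\<exists>c. (\<forall>T. c \<in> C T) \<and> c \<in> H"
    if H: "closed H" "convex H" and freq: "\<And>T. \<exists>t\<ge>T. x t \<in> H" for H
  proof -
    obtain c where c: "\<And>n. c \<in> C (a + real n) \<inter> H"
    proof (rule nested_convex_Inter_nonempty[of "\<lambda>n. C (a + real n) \<inter> H"])
      show "C (a + real n) \<inter> H \<noteq> {}" for n
      proof -
        obtain t where "t \<ge> a + real n" "x t \<in> H" using freq by blast
        with x_in_C[of "a + real n" t] show ?thesis by blast
      qed
      show "bounded (C (a + real 0) \<inter> H)" using bddC by (auto intro: bounded_subset)
      show "C (a + real n) \<inter> H \<subseteq> C (a + real m) \<inter> H" if "m \<le> n" for m n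
        using C_mono[of "a + real m" "a + real n"] that by auto
    qed (auto simp: C_closed C_convex H closed_Int convex_Int)
    have "c \<in> C T" for T
    proof -
      obtain n where "T - a \<le> real n" using real_arch_simple by blast
      then have "C (a + real n) \<subseteq> C T" by (intro C_mono) simp
      with c show ?thesis by blast
    qed
    with c show ?thesis by blast
  qed
  obtain l where l: "\<And>T. l \<in> C T" using meet[of UNIV] by auto
  then have "l \<in> S" using cluster by (simp add: C_def)
  have unique: "c = l" if c: "\<And>T. c \<in> C T" for c
  proof -
    have "c \<in> S" using cluster c by (simp add: C_def)
    obtain p q where p: "((\<lambda>t. (norm (x t - c))\<^sup>2) \<longlongrightarrow> p) at_top"
      and q: "((\<lambda>t. (norm (x t - l))\<^sup>2) \<longlongrightarrow> q) at_top"
      using fejer[OF \<open>c \<in> S\<close>] fejer[OF \<open>l \<in> S\<close>] by blast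
    have "x t \<bullet> (c - l)
        = ((norm (x t - l))\<^sup>2 - (norm (x t - c))\<^sup>2 + (norm c)\<^sup>2 - (norm l)\<^sup>2) / 2" for t
      by (simp add: power2_norm_eq_inner inner_commute algebra_simps)
    then obtain m where m: "((\<lambda>t. x t \<bullet> (c - l)) \<longlongrightarrow> m) at_top"
      using tendsto_divide[OF tendsto_diff[OF tendsto_add[OF tendsto_diff[OF q p]
        tendsto_const[of "(norm c)\<^sup>2"]] tendsto_const[of "(norm l)\<^sup>2"]] tendsto_const[of 2]]
      by auto
    have near: "\<bar>v \<bullet> (c - l) - m\<bar> \<le> e" if "e > 0" and v: "\<And>T. v \<in> C T" for e v
    proof -
      obtain T where T: "\<And>t. t \<ge> T \<Longrightarrow> \<bar>x t \<bullet> (c - l) - m\<bar> < e"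
        using tendstoD[OF m \<open>e > 0\<close>] by (auto simp: eventually_at_top_linorder dist_real_def)
      \<comment> \<open>A closed convex slab that contains a tail of \<open>x\<close>, hence also \<open>v\<close>.\<close>
      define W where "W = {v. (c - l) \<bullet> v \<le> m + e} \<inter> {v. (c - l) \<bullet> v \<ge> m - e}"
      have "C T \<subseteq> W" unfolding C_def
      proof (rule closure_convex_hull_subset)
        show "x ` {T..} \<subseteq> W" 
        proof
          fix v assume "v \<in> x ` {T..}"
          then obtain t where "t \<ge> T" "v = x t" by auto
          with T[of t] show "v \<in> W" by (simp add: W_def inner_commute abs_less_iff)
        qed
      qed (auto simp: W_def intro!: convex_Int convex_halfspace_le convex_halfspace_ge
          closed_Int closed_halfspace_le closed_halfspace_ge)
      then have "v \<in> W" using v by blast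
      then show ?thesis by (auto simp: W_def inner_commute abs_le_iff)
    qed
    have "v \<bullet> (c - l) = m" if v: "\<And>T. v \<in> C T" for v
    proof (rule ccontr)
      assume "v \<bullet> (c - l) \<noteq> m"
      with near[OF _ v, of "\<bar>v \<bullet> (c - l) - m\<bar> / 2"] show False by simp
    qed
    from this[OF c] this[OF l] have "(c - l) \<bullet> (c - l) = 0" by (simp add: inner_diff_left)
    then show ?thesis by simp
  qed
  have upper: "\<forall>\<^sub>F t in at_top. x t \<bullet> y < l \<bullet> y + e" if "e > 0" for y and e :: real
  proof (rule ccontr)
    assume "\<not> (\<forall>\<^sub>F t in at_top. x t \<bullet> y < l \<bullet> y + e)"
    then have "\<exists>t\<ge>T. x t \<in> {v. y \<bullet> v \<ge> l \<bullet> y + e}" for T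
      by (auto simp: eventually_at_top_linorder not_less inner_commute)
    from meet[OF closed_halfspace_ge convex_halfspace_ge this]
    obtain c where c: "\<And>T. c \<in> C T" "y \<bullet> c \<ge> l \<bullet> y + e" by blast
    then have "c = l" using unique by blast
    with c \<open>e > 0\<close> show False by (simp add: inner_commute)
  qed
  have "((\<lambda>t. x t \<bullet> y) \<longlongrightarrow> l \<bullet> y) at_top" for y
  proof (rule tendstoI)
    fix e :: real assume "e > 0"
    from upper[OF this, of y] upper[OF this, of "- y"]
    show "\<forall>\<^sub>F t in at_top. dist (x t \<bullet> y) (l \<bullet> y) < e"
      by eventually_elim (simp add: dist_real_def abs_less_iff)
  qed
  with \<open>l \<in> S\<close> show ?thesis by (auto simp: weakly_convergent_to_def)
qed

section \<open>Gradients and pointwise Lipschitz curves\<close>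

lemma convex_gradient_inequality:
  fixes f :: "'a::real_inner \<Rightarrow> real"
  assumes convex: "convex_on UNIV f" and deriv: "GDERIV f u :> g"
  shows "f u + g \<bullet> (v - u) \<le> f v"
proof -
  define k where "k s = f (u + s *\<^sub>R (v - u))" for s
  have "(k has_derivative (\<lambda>s. (s *\<^sub>R (v - u)) \<bullet> g)) (at 0)"
    unfolding k_def
    by (rule has_derivative_compose[where g = f])
      (auto intro!: derivative_eq_intros deriv[unfolded gderiv_def] simp: gderiv_def[symmetric] deriv)
  then have "(k has_real_derivative (v - u) \<bullet> g) (at 0)"
    by (simp add: has_field_derivative_def mult_commute_abs)
  then have "((\<lambda>s. (k s - k 0) / s) \<longlongrightarrow> (v - u) \<bullet> g) (at 0)"
    by (simp add: DERIV_def)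
  then have lim: "((\<lambda>s. (k s - k 0) / s) \<longlongrightarrow> (v - u) \<bullet> g) (at_right 0)"
    by (rule tendsto_mono[OF at_le[OF subset_UNIV]])
  have "\<forall>\<^sub>F s in at_right 0. (k s - k 0) / s \<le> f v - f u"
    using eventually_at_right_real[OF zero_less_one]
  proof eventually_elim
    fix s :: real assume s: "s \<in> {0<..<1}"
    have "k s = f ((1 - s) *\<^sub>R u + s *\<^sub>R v)" by (simp add: k_def algebra_simps)
    also have "\<dots> \<le> (1 - s) * f u + s * f v"
      using convex_onD[OF convex, of s u v] s by simp
    finally have "k s - k 0 \<le> (f v - f u) * s" by (simp add: k_def algebra_simps)
    then show "(k s - k 0) / s \<le> f v - f u" using s by (simp add: pos_divide_le_eq)
  qed
  from tendsto_upperbound[OF lim this] show ?thesis by (simp add: inner_commute)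
qed

lemma GDERIV_compose_has_real_derivative:
  assumes "GDERIV f (x t) :> g" "(x has_vector_derivative v) (at t)"
  shows "((\<lambda>s. f (x s)) has_real_derivative g \<bullet> v) (at t)"
proof -
  have "((\<lambda>s. f (x s)) has_derivative (\<lambda>s. (s *\<^sub>R v) \<bullet> g)) (at t)"
    using has_derivative_compose[OF assms(2)[unfolded has_vector_derivative_def] assms(1)[unfolded gderiv_def]] .
  then show ?thesis
    by (simp add: has_field_derivative_def inner_commute mult_commute_abs)
qed

text \<open>The pointwise form of the Lipschitz condition suffices for the null-set argument above. It holds
at every point of differentiability, so smooth summands can be added to a Lipschitz curve without
estimating their derivatives on an interval.\<close>

definition lipschitz_at :: "(real \<Rightarrow> 'a::real_normed_vector) \<Rightarrow> real \<Rightarrow> bool" where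
  "lipschitz_at h t \<longleftrightarrow> (\<exists>B. \<forall>\<^sub>F s in at t. norm (h s - h t) \<le> B * \<bar>s - t\<bar>)"

lemma lipschitz_at_if_has_vector_derivative:
  assumes "(h has_vector_derivative D) (at t)"
  shows "lipschitz_at h t"
proof -
  obtain d where d: "d > 0"
    "\<And>s. norm (s - t) < d \<Longrightarrow> norm (h s - h t - (s - t) *\<^sub>R D) \<le> 1 * norm (s - t)"
    using assms unfolding has_vector_derivative_def has_derivative_at_alt
    by (metis zero_less_one)
  have "\<forall>\<^sub>F s in at t. norm (h s - h t) \<le> (norm D + 1) * \<bar>s - t\<bar>"
    unfolding eventually_at
  proof (intro exI[of _ d] conjI ballI impI)
    fix s assume "s \<noteq> t \<and> dist s t < d"
    then have "norm (h s - h t - (s - t) *\<^sub>R D) \<le> \<bar>s - t\<bar>" using d by (simp add: dist_real_def)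
    moreover have "norm (h s - h t) \<le> norm (h s - h t - (s - t) *\<^sub>R D) + norm ((s - t) *\<^sub>R D)"
      by (metis add.commute diff_add_cancel norm_triangle_ineq)
    ultimately show "norm (h s - h t) \<le> (norm D + 1) * \<bar>s - t\<bar>"
      by (simp add: distrib_left mult.commute)
  qed (use d in auto)
  then show ?thesis unfolding lipschitz_at_def by blast
qed

lemma lipschitz_at_add:
  assumes "lipschitz_at g t" "lipschitz_at h t"
  shows "lipschitz_at (\<lambda>s. g s + h s) t"
proof -
  obtain B C where B: "\<forall>\<^sub>F s in at t. norm (g s - g t) \<le> B * \<bar>s - t\<bar>"
    and C: "\<forall>\<^sub>F s in at t. norm (h s - h t) \<le> C * \<bar>s - t\<bar>"
    using assms by (auto simp: lipschitz_at_def)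
  from B C have "\<forall>\<^sub>F s in at t. norm (g s + h s - (g t + h t)) \<le> (B + C) * \<bar>s - t\<bar>"
  proof eventually_elim
    fix s assume "norm (g s - g t) \<le> B * \<bar>s - t\<bar>" "norm (h s - h t) \<le> C * \<bar>s - t\<bar>"
    with norm_triangle_ineq[of "g s - g t" "h s - h t"]
    show "norm (g s + h s - (g t + h t)) \<le> (B + C) * \<bar>s - t\<bar>" by (simp add: algebra_simps)
  qed
  then show ?thesis unfolding lipschitz_at_def by blast
qed

lemma lipschitz_at_power2_norm:
  fixes h :: "real \<Rightarrow> 'a::real_inner"
  assumes "lipschitz_at h t" and cont: "isCont h t"
  shows "lipschitz_at (\<lambda>s. (norm (h s))\<^sup>2 / 2) t"
proof -
  obtain B where B: "\<forall>\<^sub>F s in at t. norm (h s - h t) \<le> B * \<bar>s - t\<bar>"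
    using assms by (auto simp: lipschitz_at_def)
  have "((\<lambda>s. norm (h s + h t)) \<longlongrightarrow> norm (h t + h t)) (at t)"
    using cont by (intro tendsto_intros) (simp add: isCont_def)
  then have "\<forall>\<^sub>F s in at t. norm (h s + h t) < norm (h t + h t) + 1"
    by (rule order_tendstoD) simp
  with B have "\<forall>\<^sub>F s in at t. norm ((norm (h s))\<^sup>2 / 2 - (norm (h t))\<^sup>2 / 2)
      \<le> (B * (norm (h t + h t) + 1)) * \<bar>s - t\<bar>"
  proof eventually_elim
    fix s assume s: "norm (h s - h t) \<le> B * \<bar>s - t\<bar>" "norm (h s + h t) < norm (h t + h t) + 1"
    have "(norm (h s))\<^sup>2 - (norm (h t))\<^sup>2 = (h s - h t) \<bullet> (h s + h t)"
      by (simp add: power2_norm_eq_inner inner_commute algebra_simps)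
    then have "\<bar>(norm (h s))\<^sup>2 - (norm (h t))\<^sup>2\<bar> \<le> norm (h s - h t) * norm (h s + h t)"
      using Cauchy_Schwarz_ineq2[of "h s - h t" "h s + h t"] by simp
    also have "\<dots> \<le> (B * \<bar>s - t\<bar>) * (norm (h t + h t) + 1)"
      using s by (intro mult_mono) (auto intro: order_trans[OF norm_ge_zero])
    finally show "norm ((norm (h s))\<^sup>2 / 2 - (norm (h t))\<^sup>2 / 2)
        \<le> (B * (norm (h t + h t) + 1)) * \<bar>s - t\<bar>"
      by (simp add: mult_ac diff_divide_distrib[symmetric])
  qed
  then show ?thesis unfolding lipschitz_at_def by blast
qed

lemma has_vector_derivative_interior_atLeast:
  assumes "(x has_vector_derivative v) (at t within {0::real..})" "t > 0"
  shows "(x has_vector_derivative v) (at t)"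
proof -
  have "at t within {0..} = at t" using assms(2) by (intro at_within_interior) auto
  with assms(1) show ?thesis by simp
qed

section \<open>Dissipation of energy\<close>

text \<open>Put \<open>u = x' + \<beta> \<nabla>f(x)\<close>. The inclusion says \<open>u' = - p - \<nabla>f(x)\<close> with \<open>p \<in> \<partial>\<phi>(u)\<close>, for almost
every time, so the derivative of \<open>\<parallel>u\<parallel>\<^sup>2 / 2 + f(x)\<close> is
\<open>- p \<bullet> u - \<nabla>f(x) \<bullet> u + \<nabla>f(x) \<bullet> (u - \<beta> \<nabla>f(x)) = - p \<bullet> u - \<beta> \<parallel>\<nabla>f(x)\<parallel>\<^sup>2\<close>, and the subgradient
inequality at \<open>0\<close> gives \<open>p \<bullet> u \<ge> \<phi>(u)\<close>. The primitive \<open>G\<close> stands for the integral of the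
dissipation; adding it to the energy leaves a function with nonpositive derivative almost
everywhere.\<close>

lemma energy_inequality:
  fixes f :: "'a::real_inner \<Rightarrow> real"
  assumes gradient: "\<And>w. GDERIV f w :> f' w"
    and hessian: "\<And>w. (f' has_derivative blinfun_apply (f'' w)) (at w)"
    and "\<phi> 0 = 0"
    and sol: "solution_trajectory \<beta> f' f'' \<phi> x x'"
    and G: "\<And>t. t \<ge> 0 \<Longrightarrow>
      (G has_real_derivative \<phi> (x' t + \<beta> *\<^sub>R f' (x t)) + \<beta> * (norm (f' (x t)))\<^sup>2) (at t)"
    and ab: "0 \<le> a" "a \<le> b"
  shows "(norm (x' b + \<beta> *\<^sub>R f' (x b)))\<^sup>2 / 2 + f (x b) + G b
       \<le> (norm (x' a + \<beta> *\<^sub>R f' (x a)))\<^sup>2 / 2 + f (x a) + G a"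
proof -
  define u where "u t = x' t + \<beta> *\<^sub>R f' (x t)" for t
  obtain x'' where x0: "\<And>t. t \<ge> 0 \<Longrightarrow> (x has_vector_derivative x' t) (at t within {0..})"
    and x'_cont: "continuous_on {0..} x'"
    and x'_lip: "\<And>T. T > 0 \<Longrightarrow> \<exists>L. L-lipschitz_on {0<..<T} x'"
    and AE1: "AE t\<in>{0<..} in lborel. (x' has_vector_derivative x'' t) (at t)"
    and AE2: "AE t\<in>{0<..} in lborel.
       0 \<in> {x'' t + p + \<beta> *\<^sub>R blinfun_apply (f'' (x t)) (x' t) + f' (x t) | p.
                    p \<in> subdifferential \<phi> (u t)}"
    using sol unfolding solution_trajectory_def u_def by blast
  have x_deriv: "(x has_vector_derivative x' t) (at t)" if "t > 0" for t
    using has_vector_derivative_interior_atLeast[OF x0] that by simp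
  have f'x_deriv: "((\<lambda>s. f' (x s)) has_vector_derivative blinfun_apply (f'' (x t)) (x' t)) (at t)"
    if "t > 0" for t
    using has_derivative_compose[OF x_deriv[OF that, unfolded has_vector_derivative_def] hessian]
    by (simp add: has_vector_derivative_def blinfun.scaleR_right)
  note \<beta>f'x_deriv = bounded_linear.has_vector_derivative[OF bounded_linear_scaleR_right[of \<beta>] f'x_deriv]
  have G_vec: "(G has_vector_derivative \<phi> (u t) + \<beta> * (norm (f' (x t)))\<^sup>2) (at t)" if "t \<ge> 0" for t
    using G[OF that] by (simp add: u_def has_real_derivative_iff_has_vector_derivative)
  have fx_deriv: "((\<lambda>s. f (x s)) has_real_derivative f' (x t) \<bullet> x' t) (at t)" if "t > 0" for t
    using GDERIV_compose_has_real_derivative[OF gradient x_deriv[OF that]] .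
  have x_cont: "continuous_on {0..} x"
    using has_vector_derivative_continuous[OF x0] by (auto simp: continuous_on_eq_continuous_within)
  have f_cont: "continuous_on UNIV f" "continuous_on UNIV f'"
    using has_derivative_continuous[OF gradient[unfolded gderiv_def]]
      has_derivative_continuous[OF hessian]
    by (simp_all add: continuous_at_imp_continuous_on)
  have u_cont: "continuous_on {0..} u"
    unfolding u_def
    by (intro continuous_intros x'_cont continuous_on_compose2[OF f_cont(2) x_cont]) auto
  define good where "good t \<longleftrightarrow> (x' has_vector_derivative x'' t) (at t) \<and>
      (\<exists>p\<in>subdifferential \<phi> (u t).
        x'' t + p + \<beta> *\<^sub>R blinfun_apply (f'' (x t)) (x' t) + f' (x t) = 0)" for t
  have "AE t in lborel. t > 0 \<longrightarrow> good t"
    using AE1 AE2 by eventually_elim (auto simp: good_def)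
  then obtain N where N: "N \<in> null_sets lborel" "{t \<in> space lborel. \<not> (t > 0 \<longrightarrow> good t)} \<subseteq> N"
    unfolding eventually_ae_filter by blast
  define h where "h t = (norm (u t))\<^sup>2 / 2 + (f (x t) + G t)" for t
  have "h b \<le> h a"
  proof (rule nonincreasing_if_AE_derivative_nonpos[where h = h and a = a and b = b and N = N])
    show "a \<le> b" by fact
    have "continuous_on {0..} G"
      using G by (auto intro!: continuous_at_imp_continuous_on DERIV_isCont)
    then have "continuous_on {0..} h" unfolding h_def
      by (intro continuous_intros u_cont continuous_on_compose2[OF f_cont(1) x_cont]) auto
    then show "continuous_on {a..b} h" by (rule continuous_on_subset) (use ab in auto)
    show "negligible N" using N(1) by (simp add: negligible_iff_null_sets null_sets_completionI)
  next
    fix t assume "a < t"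
    then have t: "t > 0" using ab by simp
    obtain L where L: "L-lipschitz_on {0<..<t+1} x'" using x'_lip[of "t + 1"] t by auto
    have "\<forall>\<^sub>F s in at t. s \<in> {0<..<t+1}"
      using t by (intro eventually_at_in_open' ) auto
    then have "\<forall>\<^sub>F s in at t. norm (x' s - x' t) \<le> L * \<bar>s - t\<bar>"
      by eventually_elim (use lipschitz_onD[OF L, of _ t] t in \<open>auto simp: dist_norm\<close>)
    then have "lipschitz_at x' t" unfolding lipschitz_at_def by blast
    moreover have "lipschitz_at (\<lambda>s. \<beta> *\<^sub>R f' (x s)) t"
      by (intro lipschitz_at_if_has_vector_derivative[OF \<beta>f'x_deriv] t)
    ultimately have "lipschitz_at u t"
      unfolding u_def by (rule lipschitz_at_add)
    moreover have "isCont u t"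
      using continuous_on_interior[OF u_cont, of t] t by simp
    ultimately have "lipschitz_at (\<lambda>s. (norm (u s))\<^sup>2 / 2) t" by (rule lipschitz_at_power2_norm)
    moreover have "lipschitz_at (\<lambda>s. f (x s) + G s) t"
      using fx_deriv[OF t] G_vec[of t] t
      by (intro lipschitz_at_add lipschitz_at_if_has_vector_derivative)
        (auto simp: has_real_derivative_iff_has_vector_derivative)
    ultimately have "lipschitz_at h t" unfolding h_def by (rule lipschitz_at_add)
    then show "\<exists>B. \<forall>\<^sub>F s in at t. \<bar>h s - h t\<bar> \<le> B * \<bar>s - t\<bar>" by (simp add: lipschitz_at_def)
  next
    fix t assume "a < t" "t \<notin> N"
    then have t: "t > 0" using ab by simp
    have "good t" using N(2) t \<open>t \<notin> N\<close> by auto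
    then obtain p where
      x'': "(x' has_vector_derivative x'' t) (at t)" and p: "p \<in> subdifferential \<phi> (u t)"
      and eq: "x'' t + p + \<beta> *\<^sub>R blinfun_apply (f'' (x t)) (x' t) + f' (x t) = 0"
      unfolding good_def by blast
    have "(u has_vector_derivative x'' t + \<beta> *\<^sub>R blinfun_apply (f'' (x t)) (x' t)) (at t)"
      unfolding u_def by (intro has_vector_derivative_add x'' \<beta>f'x_deriv t)
    also have "x'' t + \<beta> *\<^sub>R blinfun_apply (f'' (x t)) (x' t) = - p - f' (x t)"
      using eq by (metis add.commute add.left_commute add_eq_0_iff diff_conv_add_uminus minus_add_distrib)
    finally have u_deriv: "(u has_vector_derivative - p - f' (x t)) (at t)" .
    have "GDERIV (\<lambda>w::'a. (norm w)\<^sup>2 / 2) w :> w" for w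
      unfolding gderiv_def power2_norm_eq_inner
      by (auto intro!: derivative_eq_intros simp: inner_commute)
    from GDERIV_compose_has_real_derivative[OF this u_deriv]
    have "((\<lambda>s. (norm (u s))\<^sup>2 / 2) has_real_derivative u t \<bullet> (- p - f' (x t))) (at t)" .
    moreover have "(G has_real_derivative \<phi> (u t) + \<beta> * (norm (f' (x t)))\<^sup>2) (at t)"
      using G[of t] t by (simp add: u_def)
    ultimately have h: "(h has_real_derivative u t \<bullet> (- p - f' (x t)) +
        (f' (x t) \<bullet> x' t + (\<phi> (u t) + \<beta> * (norm (f' (x t)))\<^sup>2))) (at t)" (is "(_ has_real_derivative ?D) _")
      unfolding h_def by (intro DERIV_add fx_deriv t)
    have "f' (x t) \<bullet> x' t = f' (x t) \<bullet> u t - \<beta> * (norm (f' (x t)))\<^sup>2"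
      by (simp add: u_def inner_add_right power2_norm_eq_inner)
    then have "?D = \<phi> (u t) - p \<bullet> u t"
      by (simp add: inner_diff_right inner_commute)
    moreover have "\<phi> (u t) + p \<bullet> (0 - u t) \<le> \<phi> 0" using p unfolding subdifferential_def by blast
    ultimately have "?D \<le> 0" using \<open>\<phi> 0 = 0\<close> by simp
    with h show "\<exists>D\<le>0. (h has_real_derivative D) (at t)" by blast
  qed
  then show ?thesis by (simp add: h_def u_def)
qed

section \<open>Asymptotics of a perturbed gradient flow\<close>

text \<open>The quantity \<open>q = (\<parallel>x - z\<parallel>\<^sup>2 + 1) / 2\<close> bounds \<open>\<parallel>x - z\<parallel>\<close>. As \<open>\<nabla>f(x) \<bullet> (x - z) \<ge> 0\<close> by
convexity, it satisfies \<open>q' \<le> \<parallel>u\<parallel> q\<close>, so \<open>q exp (- U)\<close> is nonincreasing and converges. The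
constant \<open>1\<close> makes the bound on \<open>\<parallel>x - z\<parallel>\<close> linear in \<open>q\<close>, so that \<open>exp (- U)\<close> is an
integrating factor.\<close>

lemma perturbed_gradient_flow_distance_tendsto:
  fixes f :: "'a::real_inner \<Rightarrow> real"
  assumes "\<beta> \<ge> 0" and convex: "convex_on UNIV f" and gradient: "\<And>w. GDERIV f w :> f' w"
    and min: "\<And>w. f z \<le> f w"
    and x: "\<And>t. t \<ge> a \<Longrightarrow> (x has_vector_derivative u t - \<beta> *\<^sub>R f' (x t)) (at t)"
    and U: "\<And>t. t \<ge> a \<Longrightarrow> (U has_real_derivative norm (u t)) (at t)"
    and lim: "(U \<longlongrightarrow> l) at_top"
  shows "\<exists>l. ((\<lambda>t. (norm (x t - z))\<^sup>2) \<longlongrightarrow> l) at_top"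
proof -
  define q where "q t = ((norm (x t - z))\<^sup>2 + 1) / 2" for t
  have "\<exists>D. ((\<lambda>t. q t * exp (- U t)) has_real_derivative D) (at t) \<and> D \<le> 0" if t: "t \<ge> a" for t
  proof -
    have "GDERIV (\<lambda>w. ((norm (w - z))\<^sup>2 + 1) / 2) w :> (w - z)" for w
      unfolding gderiv_def power2_norm_eq_inner
      by (auto intro!: derivative_eq_intros simp: fun_eq_iff inner_commute inner_diff field_simps)
    from GDERIV_compose_has_real_derivative[OF this x[OF t]]
    have q: "(q has_real_derivative (x t - z) \<bullet> (u t - \<beta> *\<^sub>R f' (x t))) (at t)"
      by (simp add: q_def[abs_def])
    have "f (x t) + f' (x t) \<bullet> (z - x t) \<le> f z"
      by (rule convex_gradient_inequality[OF convex gradient])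
    with min[of "x t"] have "0 \<le> (x t - z) \<bullet> f' (x t)" by (simp add: inner_commute algebra_simps)
    then have "(x t - z) \<bullet> (u t - \<beta> *\<^sub>R f' (x t)) \<le> (x t - z) \<bullet> u t"
      using \<open>\<beta> \<ge> 0\<close> by (simp add: inner_diff_right)
    also have "\<dots> \<le> norm (x t - z) * norm (u t)" by (rule norm_cauchy_schwarz)
    also have "\<dots> \<le> q t * norm (u t)"
    proof (rule mult_right_mono)
      show "norm (x t - z) \<le> q t"
        using zero_le_power2[of "norm (x t - z) - 1"] by (simp add: q_def power2_diff)
    qed simp
    finally have le: "(x t - z) \<bullet> (u t - \<beta> *\<^sub>R f' (x t)) - q t * norm (u t) \<le> 0" by simp
    have "((\<lambda>t. q t * exp (- U t)) has_real_derivative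
        ((x t - z) \<bullet> (u t - \<beta> *\<^sub>R f' (x t)) - q t * norm (u t)) * exp (- U t)) (at t)"
      by (rule derivative_eq_intros q U[OF t] refl)+ (simp add: algebra_simps)
    moreover have "((x t - z) \<bullet> (u t - \<beta> *\<^sub>R f' (x t)) - q t * norm (u t)) * exp (- U t) \<le> 0"
      using le by (simp add: mult_nonpos_nonneg)
    ultimately show ?thesis by blast
  qed
  then have "antimono_on {a..} (\<lambda>t. q t * exp (- U t))"
    by (intro monotone_onI, intro DERIV_nonpos_imp_nonincreasing[where f = "\<lambda>t. q t * exp (- U t)"])
      (simp_all del: exp_ge_zero)
  then obtain m where m: "((\<lambda>t. q t * exp (- U t)) \<longlongrightarrow> m) at_top"
    by (rule antimono_on_bounded_below_tendsto[where m = 0]) (auto simp: q_def)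
  have "((\<lambda>t. 2 * (q t * exp (- U t) * exp (U t)) - 1) \<longlongrightarrow> 2 * (m * exp l) - 1) at_top"
    by (intro tendsto_intros m lim)
  moreover have "2 * (q t * exp (- U t) * exp (U t)) - 1 = (norm (x t - z))\<^sup>2" for t
    by (simp add: q_def mult.assoc exp_add[symmetric] add_divide_distrib)
  ultimately show ?thesis by auto
qed

text \<open>Along a curve of bounded speed, the Lipschitz continuity of \<open>f'\<close> makes \<open>\<parallel>f'(x)\<parallel>\<^sup>2\<close> a Lipschitz
function of time. It is integrable, hence tends to zero.\<close>

lemma gradient_along_bounded_curve_tendsto_zero:
  fixes x :: "real \<Rightarrow> 'a::real_inner" and f' :: "'a \<Rightarrow> 'b::real_normed_vector"
  assumes lip: "L-lipschitz_on (x ` {a..}) f'"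
    and x: "\<And>t. t \<ge> a \<Longrightarrow> (x has_vector_derivative x' t) (at t)"
    and x': "\<And>t. t \<ge> a \<Longrightarrow> norm (x' t) \<le> M"
    and f': "\<And>t. t \<ge> a \<Longrightarrow> norm (f' (x t)) \<le> K"
    and G: "\<And>t. t \<ge> a \<Longrightarrow> (G has_real_derivative (norm (f' (x t)))\<^sup>2) (at t)"
    and lim: "(G \<longlongrightarrow> l) at_top"
  shows "((\<lambda>t. f' (x t)) \<longlongrightarrow> 0) at_top"
proof -
  have "L \<ge> 0" using lip by (rule lipschitz_on_nonneg)
  have "K \<ge> 0" using f'[of a] norm_ge_zero[of "f' (x a)"] by linarith
  have "M \<ge> 0" using x'[of a] norm_ge_zero[of "x' a"] by linarith
  have x_lip: "norm (x s - x t) \<le> M * norm (s - t)" if "a \<le> t" "t \<le> s" for s t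
    by (rule differentiable_bound[of "{a..}" x "\<lambda>r h. h *\<^sub>R x' r"])
      (use x x' that in \<open>auto simp: has_vector_derivative_def onorm_scaleR_left
        bounded_linear_ident onorm_id intro: has_derivative_at_withinI\<close>)
  have osc: "\<bar>(norm (f' (x s)))\<^sup>2 - (norm (f' (x t)))\<^sup>2\<bar> \<le> 2 * K * L * M * (s - t)"
    if "a \<le> t" "t \<le> s" for s t
  proof -
    have "\<bar>(norm (f' (x s)))\<^sup>2 - (norm (f' (x t)))\<^sup>2\<bar>
        = \<bar>norm (f' (x s)) - norm (f' (x t))\<bar> * (norm (f' (x s)) + norm (f' (x t)))"
      by (simp add: power2_eq_square square_diff_square_factored abs_mult)
    also have "\<dots> \<le> (L * (M * (s - t))) * (2 * K)"
    proof (rule mult_mono)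
      have "\<bar>norm (f' (x s)) - norm (f' (x t))\<bar> \<le> dist (f' (x s)) (f' (x t))"
        by (simp add: dist_norm norm_triangle_ineq3)
      also have "\<dots> \<le> L * dist (x s) (x t)" by (rule lipschitz_onD[OF lip]) (use that in auto)
      also have "\<dots> \<le> L * (M * (s - t))"
        using x_lip[OF that] that \<open>L \<ge> 0\<close> by (intro mult_left_mono) (auto simp: dist_norm)
      finally show "\<bar>norm (f' (x s)) - norm (f' (x t))\<bar> \<le> L * (M * (s - t))" .
      show "norm (f' (x s)) + norm (f' (x t)) \<le> 2 * K" using f'[of s] f'[of t] that by simp
    qed (use \<open>L \<ge> 0\<close> \<open>M \<ge> 0\<close> that in auto)
    finally show ?thesis by (simp add: mult_ac)
  qed
  have "((\<lambda>t. (norm (f' (x t)))\<^sup>2) \<longlongrightarrow> 0) at_top"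
  proof (rule slowly_oscillating_tendsto_zero[OF G lim])
    fix e :: real assume "e > 0"
    define C where "C = 2 * K * L * M + 1"
    have "C > 0" using \<open>K \<ge> 0\<close> \<open>L \<ge> 0\<close> \<open>M \<ge> 0\<close> by (simp add: C_def add_nonneg_pos)
    have "\<forall>\<^sub>F t in at_top. \<forall>s\<in>{t..t + e / C}. \<bar>(norm (f' (x s)))\<^sup>2 - (norm (f' (x t)))\<^sup>2\<bar> \<le> e"
      using eventually_ge_at_top[of a]
    proof (eventually_elim, intro ballI)
      fix t s assume t: "a \<le> t" "s \<in> {t..t + e / C}"
      have "\<bar>(norm (f' (x s)))\<^sup>2 - (norm (f' (x t)))\<^sup>2\<bar> \<le> 2 * K * L * M * (s - t)"
        using osc t by simp
      also have "\<dots> \<le> C * (e / C)" using t \<open>C > 0\<close> \<open>e > 0\<close>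
        by (intro mult_mono) (auto simp: C_def)
      finally show "\<bar>(norm (f' (x s)))\<^sup>2 - (norm (f' (x t)))\<^sup>2\<bar> \<le> e" using \<open>C > 0\<close> by simp
    qed
    then show "\<exists>d>0. \<forall>\<^sub>F t in at_top. \<forall>s\<in>{t..t+d}. \<bar>(norm (f' (x s)))\<^sup>2 - (norm (f' (x t)))\<^sup>2\<bar> \<le> e"
      using \<open>e > 0\<close> \<open>C > 0\<close> by (intro exI[of _ "e / C"]) simp
  qed simp
  then have "((\<lambda>t. sqrt ((norm (f' (x t)))\<^sup>2)) \<longlongrightarrow> sqrt 0) at_top" by (rule tendsto_real_sqrt)
  then show ?thesis by (simp add: tendsto_norm_zero_iff)
qed

section \<open>Convergence of the trajectories\<close>

theorem theorem10p3:
  fixes f :: "'a::{real_inner,complete_space} \<Rightarrow> real"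
    and f' :: "'a \<Rightarrow> 'a"
    and f'' :: "'a \<Rightarrow> 'a \<Rightarrow>\<^sub>L 'a"
    and \<phi> :: "'a \<Rightarrow> real"
    and \<beta> :: real
    and x x' :: "real \<Rightarrow> 'a"
  assumes "\<beta> > 0"
    and "convex_on UNIV f"
    and gradient: "\<And>u. GDERIV f u :> f' u"
    and hessian: "\<And>u. (f' has_derivative blinfun_apply (f'' u)) (at u)"
    and "continuous_on UNIV f''"
    and "argmin f \<noteq> {}"
    and "\<And>B. bounded B \<Longrightarrow> \<exists>L. L-lipschitz_on B f'"
    and "damping_potential \<phi>"
    and "solution_trajectory \<beta> f' f'' \<phi> x x'"
  shows "antimono_on {0..} (\<lambda>t. 1/2 * (norm (x' t + \<beta> *\<^sub>R f' (x t)))\<^sup>2 + f (x t))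
    \<and> (\<integral>\<^sup>+t\<in>{0..}. ennreal (\<phi> (x' t + \<beta> *\<^sub>R f' (x t))) \<partial>lborel) < \<infinity>
    \<and> (\<integral>\<^sup>+t\<in>{0..}. ennreal ((norm (f' (x t)))\<^sup>2) \<partial>lborel) < \<infinity>
    \<and> ((\<exists>r>0. \<forall>u. \<phi> u \<ge> r * norm u) \<longrightarrow>
         (\<exists>l\<in>argmin f. weakly_convergent_to x l at_top)
         \<and> (x' \<longlongrightarrow> 0) at_top
         \<and> ((\<lambda>t. f' (x t)) \<longlongrightarrow> 0) at_top)"
proof -
  define u where "u t = x' t + \<beta> *\<^sub>R f' (x t)" for t
  define E where "E t = (norm (u t))\<^sup>2 / 2 + f (x t)" for t
  have "\<beta> > 0" and convex: "convex_on UNIV f" and "argmin f \<noteq> {}"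
    and lip: "\<And>B. bounded B \<Longrightarrow> \<exists>L. L-lipschitz_on B f'"
    and sol: "solution_trajectory \<beta> f' f'' \<phi> x x'"
    by fact+
  have \<phi>: "\<And>w. 0 \<le> \<phi> w" "\<phi> 0 = 0" "continuous_on UNIV \<phi>"
    using \<open>damping_potential \<phi>\<close> by (auto simp: damping_potential_def)
  have argmin_iff: "z \<in> argmin f \<longleftrightarrow> (\<forall>w. f z \<le> f w)" for z
    by (simp add: argmin_def is_arg_min_def not_less)
  obtain z where z: "z \<in> argmin f" using \<open>argmin f \<noteq> {}\<close> by blast
  have x0: "\<And>t. t \<ge> 0 \<Longrightarrow> (x has_vector_derivative x' t) (at t within {0..})"
    and x'_cont: "continuous_on {0..} x'"
    using sol by (auto simp: solution_trajectory_def)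
  have x_cont: "continuous_on {0..} x"
    using has_vector_derivative_continuous[OF x0] by (auto simp: continuous_on_eq_continuous_within)
  have f_cont: "continuous_on UNIV f" "continuous_on UNIV f'"
    using has_derivative_continuous[OF gradient[unfolded gderiv_def]]
      has_derivative_continuous[OF hessian]
    by (simp_all add: continuous_at_imp_continuous_on)
  have f'x_cont: "continuous_on {0..} (\<lambda>t. f' (x t))"
    by (rule continuous_on_compose2[OF f_cont(2) x_cont]) auto
  have u_cont: "continuous_on {0..} u"
    unfolding u_def by (intro continuous_intros x'_cont f'x_cont)
  have \<phi>u_cont: "continuous_on {0..} (\<lambda>t. \<phi> (u t))"
    by (rule continuous_on_compose2[OF \<phi>(3) u_cont]) auto
  have f'2_cont: "continuous_on {0..} (\<lambda>t. (norm (f' (x t)))\<^sup>2)"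
    by (intro continuous_intros f'x_cont)

  \<comment> \<open>The accumulated dissipation is \<open>P + \<beta> Q\<close>; it never exceeds the initial excess energy \<open>M\<close>.\<close>
  obtain P where P: "\<And>t. t \<ge> 0 \<Longrightarrow> (P has_real_derivative \<phi> (u t)) (at t)" "P 0 = 0"
    using primitive_on_atLeast[OF \<phi>u_cont] by metis
  obtain Q where Q: "\<And>t. t \<ge> 0 \<Longrightarrow> (Q has_real_derivative (norm (f' (x t)))\<^sup>2) (at t)" "Q 0 = 0"
    using primitive_on_atLeast[OF f'2_cont] by metis
  have P_mono: "P s \<le> P t" if "0 \<le> s" "s \<le> t" for s t
    using primitive_nonneg_mono[OF P(1) _ that] \<phi>(1) by simp
  have Q_mono: "Q s \<le> Q t" if "0 \<le> s" "s \<le> t" for s t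
    using primitive_nonneg_mono[OF Q(1) _ that] by simp
  have energy: "E b + (P b + \<beta> * Q b) \<le> E a + (P a + \<beta> * Q a)" if "0 \<le> a" "a \<le> b" for a b
  proof -
    have "((\<lambda>t. P t + \<beta> * Q t) has_real_derivative
        \<phi> (x' t + \<beta> *\<^sub>R f' (x t)) + \<beta> * (norm (f' (x t)))\<^sup>2) (at t)" if "t \<ge> 0" for t
      using DERIV_add[OF P(1)[OF that] DERIV_cmult[OF Q(1)[OF that], of \<beta>]] by (simp add: u_def)
    from energy_inequality[OF gradient hessian \<phi>(2) sol this that]
    show ?thesis by (simp add: E_def u_def)
  qed
  have E_mono: "antimono_on {0..} E"
  proof (rule monotone_onI)
    fix a b :: real assume ab: "a \<in> {0..}" "b \<in> {0..}" "a \<le> b"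
    have "\<beta> * Q a \<le> \<beta> * Q b" using Q_mono[of a b] ab \<open>\<beta> > 0\<close> by simp
    with energy[of a b] P_mono[of a b] ab show "E b \<le> E a" by simp
  qed
  have E_lower: "f z \<le> E t" for t using z[unfolded argmin_iff] by (simp add: E_def add_increasing)
  define M where "M = E 0 - f z"
  have bound: "P t + \<beta> * Q t \<le> M" if "t \<ge> 0" for t
    using energy[of 0 t] E_lower[of t] that by (simp add: M_def P(2) Q(2))
  have P_bound: "P t \<le> M" if "t \<ge> 0" for t
    using bound[OF that] Q_mono[of 0 t] that \<open>\<beta> > 0\<close> Q(2)
    by (smt (verit) mult_nonneg_nonneg)
  have Q_bound: "Q t \<le> M / \<beta>" if "t \<ge> 0" for t
    using bound[OF that] P_mono[of 0 t] that \<open>\<beta> > 0\<close> P(2)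
    by (simp add: pos_le_divide_eq mult.commute)

  have "antimono_on {0..} (\<lambda>t. 1/2 * (norm (x' t + \<beta> *\<^sub>R f' (x t)))\<^sup>2 + f (x t))"
    using E_mono by (simp add: E_def[abs_def] u_def)
  moreover have "(\<integral>\<^sup>+t\<in>{0..}. ennreal (\<phi> (x' t + \<beta> *\<^sub>R f' (x t))) \<partial>lborel) < \<infinity>"
    using nn_integral_finite_if_primitive_bounded[OF \<phi>u_cont P(1) \<phi>(1) P_bound]
    by (simp add: u_def)
  moreover have "(\<integral>\<^sup>+t\<in>{0..}. ennreal ((norm (f' (x t)))\<^sup>2) \<partial>lborel) < \<infinity>"
    using nn_integral_finite_if_primitive_bounded[OF f'2_cont Q(1) _ Q_bound] by simp
  moreover have "(\<exists>l\<in>argmin f. weakly_convergent_to x l at_top)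
         \<and> (x' \<longlongrightarrow> 0) at_top
         \<and> ((\<lambda>t. f' (x t)) \<longlongrightarrow> 0) at_top"
    if "r > 0" and r: "\<And>w. \<phi> w \<ge> r * norm w" for r
  proof -
    \<comment> \<open>The growth of \<open>\<phi>\<close> makes \<open>u\<close> integrable, so \<open>x\<close> follows a perturbed gradient flow.\<close>
    obtain U where U: "\<And>t. t \<ge> 0 \<Longrightarrow> (U has_real_derivative norm (u t)) (at t)" "U 0 = 0"
      using primitive_on_atLeast[OF continuous_on_norm[OF u_cont]] by metis
    have U_bound: "U t \<le> M / r" if "t \<ge> 0" for t
    proof -
      have "P 0 - r * U 0 \<le> P t - r * U t"
      proof (rule primitive_nonneg_mono[where G = "\<lambda>t. P t - r * U t"
            and g = "\<lambda>t. \<phi> (u t) - r * norm (u t)", OF _ _ order_refl that])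
        show "((\<lambda>t. P t - r * U t) has_real_derivative \<phi> (u s) - r * norm (u s)) (at s)"
          if "s \<ge> 0" for s
          by (intro DERIV_diff DERIV_cmult P U that)
      qed (use r in simp)
      with P_bound[OF that] \<open>r > 0\<close> show ?thesis
        by (simp add: P(2) U(2) pos_le_divide_eq mult.commute)
    qed
    obtain lU where lU: "(U \<longlongrightarrow> lU) at_top"
      by (rule bounded_primitive_tendsto[OF U(1) norm_ge_zero U_bound])
    obtain lQ where lQ: "(Q \<longlongrightarrow> lQ) at_top"
      by (rule bounded_primitive_tendsto[OF Q(1) zero_le_power2 Q_bound])
    have x_deriv: "(x has_vector_derivative x' t) (at t)" if "t \<ge> 1" for t
      using has_vector_derivative_interior_atLeast[OF x0] that by simp
    have fejer: "\<exists>l. ((\<lambda>t. (norm (x t - w))\<^sup>2) \<longlongrightarrow> l) at_top" if "w \<in> argmin f" for w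
    proof (rule perturbed_gradient_flow_distance_tendsto[of \<beta> f f' w 1 x u U lU])
      show "(x has_vector_derivative u t - \<beta> *\<^sub>R f' (x t)) (at t)" if "t \<ge> 1" for t
        using x_deriv[OF that] by (simp add: u_def)
    qed (use \<open>\<beta> > 0\<close> convex gradient that U lU in \<open>auto simp: argmin_iff\<close>)
    \<comment> \<open>Convergence of the distance to \<open>z\<close> bounds the trajectory from some time on.\<close>
    obtain a R where a: "a \<ge> 1" and R: "\<And>t. t \<ge> a \<Longrightarrow> norm (x t - z) \<le> R"
    proof -
      obtain l where "((\<lambda>t. (norm (x t - z))\<^sup>2) \<longlongrightarrow> l) at_top" using fejer[OF z] by blast
      from tendsto_real_sqrt[OF this] have "((\<lambda>t. norm (x t - z)) \<longlongrightarrow> sqrt l) at_top" by simp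
      then have "\<forall>\<^sub>F t in at_top. norm (x t - z) < sqrt l + 1" by (rule order_tendstoD) simp
      then obtain T where "\<And>t. t \<ge> T \<Longrightarrow> norm (x t - z) < sqrt l + 1"
        by (auto simp: eventually_at_top_linorder)
      then show ?thesis using that[of "max 1 T" "sqrt l + 1"] by (simp add: less_imp_le)
    qed
    have bdd: "bounded (x ` {a..})"
      unfolding bounded_def by (intro exI[of _ z] exI[of _ R]) (auto simp: dist_norm norm_minus_commute[of z] R)
    obtain L where Lz: "L-lipschitz_on (insert z (x ` {a..})) f'" using lip bdd by (metis bounded_insert)
    then have L: "L-lipschitz_on (x ` {a..}) f'" by (rule lipschitz_on_subset) auto
    define K where "K = norm (f' z) + L * R"
    have K: "norm (f' (x t)) \<le> K" if "t \<ge> a" for t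
    proof -
      have "norm (f' (x t)) \<le> norm (f' z) + norm (f' (x t) - f' z)" by (rule norm_triangle_sub)
      also have "norm (f' (x t) - f' z) \<le> L * norm (x t - z)"
        using lipschitz_onD[OF Lz, of "x t" z] that by (simp add: dist_norm)
      also have "\<dots> \<le> L * R" by (intro mult_left_mono R that lipschitz_on_nonneg[OF L])
      finally show ?thesis by (simp add: K_def)
    qed
    have u_bound: "norm (u t) \<le> sqrt (2 * M)" if "t \<ge> 0" for t
    proof (rule real_le_rsqrt)
      have "E t \<le> E 0" using E_mono that by (auto simp: monotone_on_def)
      moreover have "f z \<le> f (x t)" using z argmin_iff by blast
      ultimately show "(norm (u t))\<^sup>2 \<le> 2 * M" by (simp add: E_def[of t] M_def)
    qed
    have x'_eq: "x' t = u t - \<beta> *\<^sub>R f' (x t)" for t by (simp add: u_def)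
    have x'_bound: "norm (x' t) \<le> sqrt (2 * M) + \<beta> * K" if "t \<ge> a" for t
    proof -
      have "norm (x' t) \<le> norm (u t) + norm (\<beta> *\<^sub>R f' (x t))"
        unfolding x'_eq by (rule norm_triangle_ineq4)
      also have "\<dots> \<le> sqrt (2 * M) + \<beta> * K"
        using u_bound[of t] K[OF that] \<open>\<beta> > 0\<close> that a by (intro add_mono) auto
      finally show ?thesis .
    qed
    have f'_lim: "((\<lambda>t. f' (x t)) \<longlongrightarrow> 0) at_top"
      by (rule gradient_along_bounded_curve_tendsto_zero[OF L x_deriv x'_bound K Q(1) lQ])
        (use a in auto)
    have f_lim: "((\<lambda>t. f (x t)) \<longlongrightarrow> f z) at_top"
    proof (rule tendsto_sandwich)
      show "\<forall>\<^sub>F t in at_top. f z \<le> f (x t)" using z argmin_iff by simp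
      show "\<forall>\<^sub>F t in at_top. f (x t) \<le> f z + norm (f' (x t)) * R"
        using eventually_ge_at_top[of a]
      proof eventually_elim
        fix t assume t: "a \<le> t"
        have "f (x t) + f' (x t) \<bullet> (z - x t) \<le> f z"
          by (rule convex_gradient_inequality[OF convex gradient])
        moreover have "- (f' (x t) \<bullet> (z - x t)) \<le> norm (f' (x t)) * norm (x t - z)"
          using norm_cauchy_schwarz[of "f' (x t)" "x t - z"] by (simp add: inner_diff_right)
        moreover have "norm (f' (x t)) * norm (x t - z) \<le> norm (f' (x t)) * R"
          using R[OF t] by (intro mult_left_mono) auto
        ultimately show "f (x t) \<le> f z + norm (f' (x t)) * R" by linarith
      qed
      have "((\<lambda>t. f z + norm (f' (x t)) * R) \<longlongrightarrow> f z + norm (0::'a) * R) at_top"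
        by (intro tendsto_intros f'_lim)
      then show "((\<lambda>t. f z + norm (f' (x t)) * R) \<longlongrightarrow> f z) at_top" by simp
    qed simp
    \<comment> \<open>The energy and \<open>f (x t)\<close> both converge, so \<open>norm (u t)\<close> has a limit; as \<open>u\<close> is integrable, that limit is zero.\<close>
    obtain lE where "(E \<longlongrightarrow> lE) at_top"
      using antimono_on_bounded_below_tendsto[OF E_mono E_lower] by blast
    then have "((\<lambda>t. sqrt (2 * (E t - f (x t)))) \<longlongrightarrow> sqrt (2 * (lE - f z))) at_top"
      by (intro tendsto_intros f_lim)
    then have u_conv: "((\<lambda>t. norm (u t)) \<longlongrightarrow> sqrt (2 * (lE - f z))) at_top"
      by (simp add: E_def)
    have "((\<lambda>t. norm (u t)) \<longlongrightarrow> 0) at_top"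
    proof (rule slowly_oscillating_tendsto_zero[OF U(1) lU])
      fix e :: real assume "e > 0"
      define m where "m = sqrt (2 * (lE - f z))"
      obtain T where T: "\<And>t. t \<ge> T \<Longrightarrow> \<bar>norm (u t) - m\<bar> < e / 2"
        using tendstoD[OF u_conv, of "e / 2"] \<open>e > 0\<close>
        by (auto simp: eventually_at_top_linorder dist_real_def m_def)
      have "\<forall>\<^sub>F t in at_top. \<forall>s\<in>{t..t + 1}. \<bar>norm (u s) - norm (u t)\<bar> \<le> e"
        using eventually_ge_at_top[of T]
      proof (eventually_elim, intro ballI)
        fix t s assume "T \<le> t" "s \<in> {t..t + 1}"
        with T[of s] T[of t] show "\<bar>norm (u s) - norm (u t)\<bar> \<le> e" by (simp; argo)
      qed
      then show "\<exists>d>0. \<forall>\<^sub>F t in at_top. \<forall>s\<in>{t..t + d}. \<bar>norm (u s) - norm (u t)\<bar> \<le> e"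
        by (intro exI[of _ 1]) simp
    qed
    then have u_lim: "(u \<longlongrightarrow> 0) at_top" by (rule tendsto_norm_zero_cancel)
    have "((\<lambda>t. u t - \<beta> *\<^sub>R f' (x t)) \<longlongrightarrow> 0 - \<beta> *\<^sub>R 0) at_top"
      by (intro tendsto_intros u_lim f'_lim)
    then have x'_lim: "(x' \<longlongrightarrow> 0) at_top" by (simp add: u_def)
    have "\<exists>l\<in>argmin f. weakly_convergent_to x l at_top"
    \<comment> \<open>Sublevel sets of \<open>f\<close> are closed and convex, so common points of the hulls minimize \<open>f\<close>.\<close>
    proof (rule opial_weak_convergence[OF bdd fejer])
      fix c assume c: "\<And>T. c \<in> closure (convex hull (x ` {T..}))"
      have "f c \<le> f z"
      proof (rule field_le_epsilon)
        fix e :: real assume "e > 0"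
        then have "\<forall>\<^sub>F t in at_top. f (x t) < f z + e" by (intro order_tendstoD[OF f_lim]) simp
        then obtain T where T: "\<And>t. t \<ge> T \<Longrightarrow> f (x t) < f z + e"
          by (auto simp: eventually_at_top_linorder)
        then have "convex hull (x ` {T..}) \<subseteq> {w. f w \<le> f z + e}"
          using convex_on_convex_hull_bound[of "x ` {T..}" f "f z + e"] convex_on_subset[OF convex]
          by (fastforce intro: less_imp_le)
        moreover have "closed {w. f w \<le> f z + e}"
          by (intro closed_Collect_le f_cont continuous_intros)
        ultimately have "closure (convex hull (x ` {T..})) \<subseteq> {w. f w \<le> f z + e}"
          by (rule closure_minimal)
        with c show "f c \<le> f z + e" by blast
      qed
      then show "c \<in> argmin f" using z by (auto simp: argmin_iff intro: order_trans)
    qed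
    with x'_lim f'_lim show ?thesis by blast
  qed
  ultimately show ?thesis by blast
qed

end
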